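(* Let $I\subset\mathbb{R}$ be an interval, let $f:I\to\mathbb{R}$ be differentiable on the interior $I^{\circ}$ with $f'\in L[a,b]$, where $a,b\in I^{\circ}$, $a<b$. If $|f'|^{q}$ is quasi-convex on $[a,b]$ for some $q\ge 1$, then $$\left|f\left(\frac{a+b}{2}\right)-\frac{1}{b-a}\int_a^b f(x)\,dx\right|\le \frac{b-a}{4}\left(\sup\{|f'(a)|^q,|f'(b)|^q\}\right)^{1/q}.$$
   Context: A function $g:[a,b]\to\mathbb{R}$ is quasi-convex on $[a,b]$ if $g(tx+(1-t)y)\le\sup\{g(x),g(y)\}$ for all $x,y\in[a,b]$ and $t\in[0,1]$. $L[a,b]$ denotes the set of Lebesgue integrable functions on $[a,b]$. *)

theory Defs
  imports "HOL-Analysis.Analysis"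
begin

text \<open>Convexity of the domain is part of the definition, as in the library's \<^const>\<open>convex_on\<close>;
  it holds automatically for the intervals \<open>{a..b}\<close>.\<close>

definition quasi_convex_on :: "real set \<Rightarrow> (real \<Rightarrow> real) \<Rightarrow> bool" where
  "quasi_convex_on S g \<longleftrightarrow> convex S \<and>
     (\<forall>x\<in>S. \<forall>y\<in>S. \<forall>t\<in>{0..1}. g (t * x + (1 - t) * y) \<le> Sup {g x, g y})"

end

theory Submission
  imports Defs
begin

text \<open>Quasi-convexity bounds \<open>\<bar>f'\<bar>\<close> on \<open>{a..b}\<close> by its maximum \<open>K\<close> at the endpoints, so \<open>f\<close> is
  \<open>K\<close>-Lipschitz there. Averaging \<open>\<bar>f x - f c\<bar> \<le> K \<bar>x - c\<bar>\<close> over \<open>{a..b}\<close>, with \<open>c\<close> the midpoint,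
  gives the factor \<open>(b - a) / 4\<close>.\<close>

text \<open>Each point of the interval is a convex combination of \<open>a\<close> and
  \<open>b\<close>, so the defining inequality is only needed at this pair.\<close>

lemma quasi_convex_on_le_endpoints:
  assumes "quasi_convex_on {a..b} g" "x \<in> {a..b}"
  shows "g x \<le> Sup {g a, g b}"
proof -
  have "x \<in> closed_segment a b"
    using assms(2) by (simp add: closed_segment_eq_real_ivl)
  then obtain u where u: "0 \<le> u" "u \<le> 1" "x = (1 - u) * a + u * b"
    by (auto simp: closed_segment_def)
  \<comment> \<open>The definition puts the weight \<open>t\<close> on the first point, hence
    \<open>t = 1 - u\<close>.\<close>
  have "g ((1 - u) * a + (1 - (1 - u)) * b) \<le> Sup {g a, g b}"
    using assms u(1,2) unfolding quasi_convex_on_def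
    by (meson atLeastAtMost_iff diff_ge_0_iff_ge diff_le_eq le_add_same_cancel1 order_refl order_trans)
  with u(3) show ?thesis by simp
qed

text \<open>On each side of \<open>c\<close> the sign of \<open>x - c\<close> is constant; the graph
  cuts out two right triangles with legs \<open>c - a\<close> and \<open>b - c\<close>.\<close>

lemma has_integral_abs_diff:
  fixes a b c :: real
  assumes "a \<le> c" "c \<le> b"
  shows "((\<lambda>x. \<bar>x - c\<bar>) has_integral ((c - a)\<^sup>2 + (b - c)\<^sup>2) / 2) {a..b}"
proof -
  \<comment> \<open>The antiderivative is \<open>- (c - x)\<^sup>2 / 2\<close>; the vanishing term
    at \<open>c\<close> is kept so that the value has the form \<open>F c - F a\<close>.\<close>
  have "((\<lambda>x. c - x) has_integral (- (c - c)\<^sup>2 / 2 - - (c - a)\<^sup>2 / 2)) {a..c}"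
    using assms by (intro fundamental_theorem_of_calculus)
      (auto intro!: derivative_eq_intros simp: field_simps simp flip: has_real_derivative_iff_has_vector_derivative)
  then have left: "((\<lambda>x. \<bar>x - c\<bar>) has_integral (c - a)\<^sup>2 / 2) {a..c}"
    by (auto elim: has_integral_eq_rhs intro: has_integral_eq[rotated])
  have "((\<lambda>x. x - c) has_integral ((b - c)\<^sup>2 / 2 - (c - c)\<^sup>2 / 2)) {c..b}"
    using assms by (intro fundamental_theorem_of_calculus)
      (auto intro!: derivative_eq_intros simp flip: has_real_derivative_iff_has_vector_derivative)
  then have right: "((\<lambda>x. \<bar>x - c\<bar>) has_integral (b - c)\<^sup>2 / 2) {c..b}"
    by (auto elim: has_integral_eq_rhs intro: has_integral_eq[rotated])
  show ?thesis
    using has_integral_combine[OF assms left right] by (simp add: add_divide_distrib)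
qed

lemma lipschitz_midpoint_inequality:
  fixes f :: "real \<Rightarrow> real"
  assumes "a < b" and lip: "K-lipschitz_on {a..b} f"
  shows "\<bar>f ((a + b) / 2) - 1 / (b - a) * integral {a..b} f\<bar> \<le> (b - a) / 4 * K"
proof -
  define c where "c = (a + b) / 2"
  have c: "a \<le> c" "c \<le> b" using assms(1) by (auto simp: c_def)
  have f: "f integrable_on {a..b}"
    using lipschitz_on_continuous_on[OF lip] by (rule integrable_continuous_real)
  have bound: "((\<lambda>x. K * \<bar>x - c\<bar>) has_integral K * (((c - a)\<^sup>2 + (b - c)\<^sup>2) / 2)) {a..b}"
    by (intro has_integral_mult_right has_integral_abs_diff c)
  \<comment> \<open>With the constant \<open>f c\<close> moved under the integral, the Lipschitz
    bound applies pointwise.\<close>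
  have "norm (integral {a..b} (\<lambda>x. f x - f c)) \<le> integral {a..b} (\<lambda>x. K * \<bar>x - c\<bar>)"
  proof (rule integral_norm_bound_integral)
    show "(\<lambda>x. f x - f c) integrable_on {a..b}"
      using f by (intro integrable_diff) auto
    show "(\<lambda>x. K * \<bar>x - c\<bar>) integrable_on {a..b}"
      using bound by blast
    show "norm (f x - f c) \<le> K * \<bar>x - c\<bar>" if "x \<in> {a..b}" for x
      using lipschitz_onD[OF lip that, of c] c by (simp add: dist_real_def)
  qed
  also have "\<dots> = K * (((c - a)\<^sup>2 + (b - c)\<^sup>2) / 2)"
    using bound by (rule integral_unique)
  \<comment> \<open>At the midpoint both triangles have legs \<open>(b - a) / 2\<close>.\<close>
  also have "\<dots> = (b - a)\<^sup>2 / 4 * K"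
    by (simp add: c_def field_simps power2_eq_square)
  finally have "\<bar>integral {a..b} f - (b - a) * f c\<bar> \<le> (b - a)\<^sup>2 / 4 * K"
    using f assms(1) by (simp add: integral_diff integrable_const_ivl)
  moreover have "f c - 1 / (b - a) * integral {a..b} f
      = - (integral {a..b} f - (b - a) * f c) / (b - a)"
    using assms(1) by (simp add: field_simps)
  ultimately show ?thesis
    using assms(1) by (simp add: c_def abs_minus_commute abs_divide field_simps power2_eq_square)
qed

theorem corollary3:
  fixes I :: "real set" and f :: "real \<Rightarrow> real" and a b q :: real
  assumes "is_interval I"
    and "\<forall>x\<in>interior I. f differentiable (at x)"
    and "a \<in> interior I" and "b \<in> interior I" and "a < b"
    and "set_integrable lebesgue {a..b} (deriv f)"
    and "q \<ge> 1"
    and "quasi_convex_on {a..b} (\<lambda>x. \<bar>deriv f x\<bar> powr q)"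
  shows "\<bar>f ((a + b) / 2) - 1 / (b - a) * integral {a..b} f\<bar>
    \<le> (b - a) / 4 * (Sup {\<bar>deriv f a\<bar> powr q, \<bar>deriv f b\<bar> powr q}) powr (1 / q)"
proof (rule lipschitz_midpoint_inequality[OF \<open>a < b\<close>])
  define M where "M = Sup {\<bar>deriv f a\<bar> powr q, \<bar>deriv f b\<bar> powr q}"
  have "convex (interior I)"
    using assms(1) by (simp add: is_interval_convex convex_interior)
  \<comment> \<open>Thus \<open>f\<close> is differentiable at the endpoints too, and
    \<open>deriv f\<close> is a genuine derivative on all of \<open>{a..b}\<close>.\<close>
  then have sub: "{a..b} \<subseteq> interior I"
    using assms(3-5) closed_segment_subset[of a "interior I" b]
    by (simp add: closed_segment_eq_real_ivl)
  have der: "(f has_field_derivative deriv f x) (at x within {a..b})" if "x \<in> {a..b}" for x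
    using assms(2) sub that
    by (meson DERIV_deriv_iff_real_differentiable has_field_derivative_at_within subsetD)
  have deriv_le: "norm (deriv f x) \<le> M powr (1 / q)" if "x \<in> {a..b}" for x
  proof -
    \<comment> \<open>Quasi-convexity controls only the \<open>q\<close>-th power; since
      \<open>q > 0\<close>, the monotone \<open>q\<close>-th root recovers a bound on
      \<open>deriv f\<close> itself.\<close>
    have "\<bar>deriv f x\<bar> = (\<bar>deriv f x\<bar> powr q) powr (1 / q)"
      using assms(7) by (simp add: powr_powr)
    also have "\<dots> \<le> M powr (1 / q)"
      using quasi_convex_on_le_endpoints[OF assms(8) that] assms(7)
      by (intro powr_mono2) (auto simp: M_def)
    finally show ?thesis by simp
  qed
  show "(M powr (1 / q))-lipschitz_on {a..b} f"
  proof (rule lipschitz_onI)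
    \<comment> \<open>Mean value inequality on the convex set \<open>{a..b}\<close>.\<close>
    show "dist (f x) (f y) \<le> M powr (1 / q) * dist x y" if "x \<in> {a..b}" "y \<in> {a..b}" for x y
      using field_differentiable_bound[OF convex_real_interval(5) der deriv_le that]
      by (simp add: dist_norm)
  qed simp
qed

end
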